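(* For all time series $S$ and $T$ over $\mathbb R^k$, $d^\delta_m(S,T)\le 2\cdot d^C_1(S,T)$.
   Context: A time series over $\mathbb R^k$ is a finite sequence $T=(t_0,\dots,t_{n-1})$ of vectors in $\mathbb R^k$, with length $\#T=n$; $T_b^\ell=(t_b,\dots,t_{b+\ell-1})$. For equal-length $S,T$, $d_1(S,T)=\sum_i\|s_i-t_i\|_2$; if $\#S=m\le n=\#T$, $d_1(S,T)=d_1(T,S)=\min_{b\in[0,n-m]}d_1(S,T_b^m)$. $d_1^C(S,T)=\inf_{M,v}d_1(S,M\cdot T+v)$ over real orthogonal $k\times k$ matrices $M$ and $v\in\mathbb R^k$, where $M\cdot T+v=(Mt_i+v)_i$. The reduced structure of $T$ is $\delta T=(\|t_i-t_{i+j}\|_2)_{i\in[0,n-1),\,j\in[1,n-i),\,j\text{ a power of }2}$. For equal-length $S,T$, $d^\delta_m(S,T)=\max_j\sum_i|(\delta S)_{i,j}-(\delta T)_{i,j}|$ (max column norm, columns indexed by $j$); for $\#S=m\le n=\#T$, $d^\delta_m(S,T)=d^\delta_m(T,S)=\min_{b\in[0,n-m]}d^\delta_m(S,T_b^m)$. *)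

theory Defs
  imports "HOL-Analysis.Analysis"
begin

type_synonym 'k time_series = "(real ^ 'k) list"

definition subseries :: "'a list \<Rightarrow> nat \<Rightarrow> nat \<Rightarrow> 'a list" where
  "subseries T b l = take l (drop b T)"

text \<open>Extension of a distance on equal-length series to arbitrary lengths: the shorter
  series is slid along the longer one.\<close>

definition sliding :: "('a list \<Rightarrow> 'a list \<Rightarrow> real) \<Rightarrow> 'a list \<Rightarrow> 'a list \<Rightarrow> real" where
  "sliding d S T =
    (if length S \<le> length T
     then Min ((\<lambda>b. d S (subseries T b (length S))) ` {0..length T - length S})
     else Min ((\<lambda>b. d T (subseries S b (length T))) ` {0..length S - length T}))"

lemma sliding_eq_length: "length S = length T \<Longrightarrow> sliding d S T = d S T"
  by (simp add: sliding_def subseries_def)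

definition d1_eq :: "'k::finite time_series \<Rightarrow> 'k time_series \<Rightarrow> real" where
  "d1_eq S T = (\<Sum>i<length S. norm (S ! i - T ! i))"

definition d1 :: "'k::finite time_series \<Rightarrow> 'k time_series \<Rightarrow> real" where
  "d1 = sliding d1_eq"

definition transform_series ::
  "real ^ 'k ^ 'k \<Rightarrow> real ^ 'k \<Rightarrow> 'k::finite time_series \<Rightarrow> 'k time_series" where
  "transform_series M v T = map (\<lambda>t. M *v t + v) T"

definition d1C :: "'k::finite time_series \<Rightarrow> 'k time_series \<Rightarrow> real" where
  "d1C S T = Inf {d1 S (transform_series M v T) | M v. orthogonal_matrix M}"

definition delta_index :: "nat \<Rightarrow> (nat \<times> nat) set" where
  "delta_index n = {(i, j). i < n - 1 \<and> 1 \<le> j \<and> j < n - i \<and> (\<exists>p::nat. j = 2 ^ p)}"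

text \<open>Entry \<open>(i, j)\<close> of the reduced structure; only meaningful for
  \<open>(i, j) \<in> delta_index (length T)\<close>.\<close>

definition reduced_structure :: "'k::finite time_series \<Rightarrow> nat \<Rightarrow> nat \<Rightarrow> real" where
  "reduced_structure T i j = norm (T ! i - T ! (i + j))"

text \<open>The reduced structure of a series of length at most 1 has no columns; the maximum
  column norm is then 0.\<close>

definition ddelta_eq :: "'k::finite time_series \<Rightarrow> 'k time_series \<Rightarrow> real" where
  "ddelta_eq S T =
    (let I = delta_index (length S) in
     if I = {} then 0
     else Max ((\<lambda>j. \<Sum>i | (i, j) \<in> I. \<bar>reduced_structure S i j - reduced_structure T i j\<bar>)
               ` (snd ` I)))"

definition ddelta :: "'k::finite time_series \<Rightarrow> 'k time_series \<Rightarrow> real" where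
  "ddelta = sliding ddelta_eq"

end

theory Submission
  imports Defs
begin

text \<open>The reduced structure is invariant under isometries, so it suffices to compare
  \<open>ddelta\<close> with \<open>d1\<close>. By the triangle inequality, the entry \<open>(i, j)\<close> changes by at most
  \<open>norm (S ! i - T ! i) + norm (S ! (i + j) - T ! (i + j))\<close>, and each index occurs at most
  twice in these bounds when \<open>i\<close> runs through column \<open>j\<close>: once as \<open>i\<close>, once as \<open>i + j\<close>.\<close>

text \<open>The shift that attains the minimum for \<open>d'\<close> is also a candidate in the
  minimum for \<open>d\<close>, so a bound for equal lengths survives sliding with the same
  factor.\<close>

lemma sliding_le_mult:
  assumes le: "\<And>A B. length A = length B \<Longrightarrow> d A B \<le> c * d' A B"
  shows "sliding d S T \<le> c * sliding d' S T"
proof -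
  have slide: "Min ((\<lambda>b. d A (subseries B b (length A))) ` {0..length B - length A})
      \<le> c * Min ((\<lambda>b. d' A (subseries B b (length A))) ` {0..length B - length A})"
    if AB: "length A \<le> length B" for A B
  proof -
    let ?F = "(\<lambda>b. d' A (subseries B b (length A))) ` {0..length B - length A}"
    have "Min ?F \<in> ?F"
      by (rule Min_in) auto
    then obtain b where b: "b \<in> {0..length B - length A}"
      and eq: "Min ?F = d' A (subseries B b (length A))"
      by blast
    have "Min ((\<lambda>b. d A (subseries B b (length A))) ` {0..length B - length A})
        \<le> d A (subseries B b (length A))"
      using b by (intro Min_le) auto
    also have "\<dots> \<le> c * d' A (subseries B b (length A))"
      using AB b by (intro le) (auto simp: subseries_def)
    finally show ?thesis
      using eq by simp
  qed
  show ?thesis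
    using slide[of S T] slide[of T S] by (auto simp: sliding_def)
qed

lemma finite_delta_index: "finite (delta_index n)"
  by (rule finite_subset[of _ "{..n} \<times> {..n}"]) (auto simp: delta_index_def)

text \<open>Agreement is asked only for \<open>i + j < length S\<close>: \<open>delta_index\<close>
  contains only such pairs, and list access beyond the end is unspecified.\<close>

lemma ddelta_eq_cong:
  assumes "length S = length S'"
    and "\<And>i j. i + j < length S \<Longrightarrow> reduced_structure S i j = reduced_structure S' i j"
    and "\<And>i j. i + j < length S \<Longrightarrow> reduced_structure T i j = reduced_structure T' i j"
  shows "ddelta_eq S T = ddelta_eq S' T'"
proof -
  have "(\<Sum>i | (i, j) \<in> delta_index (length S). \<bar>reduced_structure S i j - reduced_structure T i j\<bar>)
      = (\<Sum>i | (i, j) \<in> delta_index (length S). \<bar>reduced_structure S' i j - reduced_structure T' i j\<bar>)"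
    for j
    using assms(2,3) by (intro sum.cong) (auto simp: delta_index_def)
  then show ?thesis
    using assms(1) by (simp add: ddelta_eq_def Let_def)
qed

text \<open>The translation \<open>v\<close> cancels in the difference of two points, and an
  orthogonal \<open>M\<close> preserves its norm.\<close>

lemma reduced_structure_transform_series:
  assumes "orthogonal_matrix M" and "i + j < length T"
  shows "reduced_structure (transform_series M v T) i j = reduced_structure T i j"
proof -
  have "norm (M *v x) = norm x" for x
    using assms(1) orthogonal_transformation_matrix[of "(*v) M"]
    by (simp add: orthogonal_transformation)
  then show ?thesis
    using assms(2)
    by (simp add: reduced_structure_def transform_series_def
        flip: matrix_vector_mult_diff_distrib)
qed

lemma subseries_transform_series:
  "subseries (transform_series M v T) b l = transform_series M v (subseries T b l)"
  by (simp add: subseries_def transform_series_def take_map drop_map)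

lemma ddelta_transform_series:
  assumes "orthogonal_matrix M"
  shows "ddelta S (transform_series M v T) = ddelta S T"
proof -
  have len: "length (transform_series M v A) = length A" for A
    by (simp add: transform_series_def)
  \<comment> \<open>Here windows of the transformed series are compared. The bounds on
    \<open>b\<close> ensure that the window of \<open>T\<close> has full length
    \<open>length S\<close>, so every entry read lies inside it; \<open>image_cong_simp\<close>
    later supplies these bounds under the minimum.\<close>
  have right: "ddelta_eq S (subseries (transform_series M v T) b (length S))
      = ddelta_eq S (subseries T b (length S))"
    if "length S \<le> length T" "b \<le> length T - length S" for b
    using that unfolding subseries_transform_series
    by (intro ddelta_eq_cong refl reduced_structure_transform_series[OF assms])
      (auto simp: subseries_def)
  have left: "ddelta_eq (transform_series M v T) A = ddelta_eq T A" for A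
    by (intro ddelta_eq_cong refl reduced_structure_transform_series[OF assms])
      (simp_all add: len)
  show ?thesis
    by (auto simp: ddelta_def sliding_def len left right cong: image_cong_simp)
qed

lemma ddelta_eq_le_d1_eq:
  assumes len: "length S = length T"
  shows "ddelta_eq S T \<le> 2 * d1_eq S T"
proof (cases "delta_index (length S) = {}")
  case True
  then show ?thesis
    by (simp add: ddelta_eq_def d1_eq_def sum_nonneg)
next
  case False
  let ?e = "\<lambda>i. norm (S ! i - T ! i)"
  have column: "(\<Sum>i | (i, j) \<in> delta_index (length S).
      \<bar>reduced_structure S i j - reduced_structure T i j\<bar>) \<le> 2 * d1_eq S T" for j
  proof -
    let ?I = "{i. (i, j) \<in> delta_index (length S)}"
    have "(\<Sum>i\<in>?I. \<bar>reduced_structure S i j - reduced_structure T i j\<bar>)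
        \<le> (\<Sum>i\<in>?I. ?e i + ?e (i + j))"
      unfolding reduced_structure_def by (intro sum_mono) norm
    also have "\<dots> = sum ?e ?I + sum ?e ((\<lambda>i. i + j) ` ?I)"
      by (simp add: sum.distrib sum.reindex)
    \<comment> \<open>Both \<open>?I\<close> and its shift by \<open>j\<close> lie in
      \<open>{..<length S}\<close>, because \<open>delta_index\<close> forces
      \<open>i + j < length S\<close>; enlarging either sum only adds nonnegative terms.\<close>
    also have "\<dots> \<le> d1_eq S T + d1_eq S T"
      unfolding d1_eq_def by (intro add_mono sum_mono2) (auto simp: delta_index_def)
    finally show ?thesis
      by simp
  qed
  then show ?thesis
    using False by (simp add: ddelta_eq_def Let_def finite_delta_index)
qed

lemma ddelta_le_d1: "ddelta S T \<le> 2 * d1 S T"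
  unfolding ddelta_def d1_def by (rule sliding_le_mult[OF ddelta_eq_le_d1_eq])

theorem theorem6:
  fixes S T :: "(real ^ 'k::finite) list"
  shows "ddelta S T \<le> 2 * d1C S T"
proof -
  \<comment> \<open>With the factor moved to the left, the claim is that
    \<open>ddelta S T / 2\<close> is a lower bound of the set whose infimum is
    \<open>d1C S T\<close>.\<close>
  have "ddelta S T / 2 \<le> d1C S T"
    unfolding d1C_def
  proof (rule cInf_greatest)
    show "{d1 S (transform_series M v T) |M v. orthogonal_matrix M} \<noteq> {}"
      using orthogonal_matrix_id by blast
  next
    fix x
    assume "x \<in> {d1 S (transform_series M v T) |M v. orthogonal_matrix M}"
    then obtain M v where "orthogonal_matrix M" and "x = d1 S (transform_series M v T)"
      by blast
    then show "ddelta S T / 2 \<le> x"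
      using ddelta_le_d1[of S "transform_series M v T"] by (simp add: ddelta_transform_series)
  qed
  then show ?thesis
    by simp
qed

end
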